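(* Let $n\ge 1$ be an integer and let $s\in(0,1)$. There exists a bounded function $u:\mathbb{R}^n\to\mathbb{R}$ which is $s$-harmonic in $B_1$ (that is, $(-\Delta)^s u(x)=0$ for every $x\in B_1$), nonnegative in $B_1$, not identically $0$ in $B_1$, but such that $$\inf_{B_{1/2}} u = 0.$$
   Context: $B_r\subset\mathbb{R}^n$ denotes the open ball of radius $r$ centered at the origin. For $s\in(0,1)$ the fractional Laplacian of a function $u:\mathbb{R}^n\to\mathbb{R}$ at a point $x$ is defined (dropping a normalizing constant) by $$(-\Delta)^s u(x):=\int_{\mathbb{R}^n}\frac{2u(x)-u(x+y)-u(x-y)}{|y|^{n+2s}}\,dy .$$ Here $u$ is supposed to be measurable on $\mathbb{R}^n$, sufficiently smooth near $x$ (to make the integral convergent for small $y$) and with some growth control at infinity (to make it convergent for large $y$; boundedness suffices). When $u$ is said to be $s$-harmonic in $B_1$, the smoothness requirement is understood as $u\in C^2(B_1)$. A function $u$ is called $s$-harmonic at $x$ if $(-\Delta)^s u(x)=0$, and $s$-harmonic in an open set if this holds at every point of that set. Note that $u$ must be defined on all of $\mathbb{R}^n$, and no sign condition is imposed on $u$ outside $B_1$. *)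

theory Defs
  imports "HOL-Analysis.Analysis"
begin

definition frac_integrand :: "real \<Rightarrow> (real ^ 'n \<Rightarrow> real) \<Rightarrow> real ^ 'n \<Rightarrow> real ^ 'n \<Rightarrow> real" where
  "frac_integrand s u x y =
     (2 * u x - u (x + y) - u (x - y)) / norm y powr (real CARD('n) + 2 * s)"

definition frac_laplacian :: "real \<Rightarrow> (real ^ 'n \<Rightarrow> real) \<Rightarrow> real ^ 'n \<Rightarrow> real" where
  "frac_laplacian s u x = (LINT y|lebesgue. frac_integrand s u x y)"

(* The Bochner integral of a non-integrable function is 0 by convention, so
   convergence of the integral has to be required separately. *)
definition s_harmonic_at :: "real \<Rightarrow> (real ^ 'n \<Rightarrow> real) \<Rightarrow> real ^ 'n \<Rightarrow> bool" where
  "s_harmonic_at s u x \<longleftrightarrow>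
     integrable lebesgue (frac_integrand s u x) \<and> frac_laplacian s u x = 0"

(* Derivatives are taken at x in the whole space, so S is meant to be open. *)
definition C2_on :: "'a::real_normed_vector set \<Rightarrow> ('a \<Rightarrow> real) \<Rightarrow> bool" where
  "C2_on S u \<longleftrightarrow>
     (\<exists>(u' :: 'a \<Rightarrow> 'a \<Rightarrow>\<^sub>L real) (u'' :: 'a \<Rightarrow> 'a \<Rightarrow>\<^sub>L 'a \<Rightarrow>\<^sub>L real).
        (\<forall>x\<in>S. (u has_derivative blinfun_apply (u' x)) (at x)) \<and>
        (\<forall>x\<in>S. (u' has_derivative blinfun_apply (u'' x)) (at x)) \<and>
        continuous_on S u'')"

definition s_harmonic_on :: "real \<Rightarrow> (real ^ 'n) set \<Rightarrow> (real ^ 'n \<Rightarrow> real) \<Rightarrow> bool" where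
  "s_harmonic_on s S u \<longleftrightarrow>
     u \<in> borel_measurable lebesgue \<and> C2_on S u \<and> (\<forall>x\<in>S. s_harmonic_at s u x)"

end

theory Submission
  imports Defs "HOL-Real_Asymp.Real_Asymp"
begin

text \<open>
  Let \<open>h\<^sub>R(x) = max 0 (R - norm x\<^sup>2) powr s\<close>. By Getoor, the fractional Laplacian of \<open>h\<^sub>R\<close> is constant on the ball of
  radius \<open>sqrt R\<close>, with a constant independent of \<open>R\<close>. So \<open>h\<^sub>4 - h\<^sub>1\<close> is \<open>s\<close>-harmonic in the unit ball, and so is
  \<open>u = h\<^sub>4 - h\<^sub>1 - (4 powr s - 1)\<close>. This \<open>u\<close> is bounded and vanishes at the origin, and in the unit ball it is
  strictly increasing in \<open>norm x\<close>.

  To see that the constant depends on neither \<open>R\<close> nor \<open>x\<close>, restrict \<open>h\<^sub>R\<close> to the line through \<open>x\<close> in the direction \<open>y\<close>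
  and put \<open>a = R - norm x\<^sup>2\<close>, \<open>b = x \<bullet> y\<close>, \<open>c = norm y\<^sup>2\<close>. In terms of the inverse radius \<open>v\<close> the line integral becomes the
  integral over \<open>v > 0\<close> of \<open>(2 a\<^sup>s v\<^bsup>2s\<^esup> - (a v\<^sup>2 - 2 b v - c)\<^sub>+\<^sup>s - (a v\<^sup>2 + 2 b v - c)\<^sub>+\<^sup>s) / v\<close>.
  The two truncated powers combine into the single integral of \<open>(q - c)\<^sub>+\<^sup>s / q\<close> by the substitution
  \<open>q = a v w\<close>, where \<open>w = v - 2 b / a\<close>; a rescaling of \<open>v\<close> then removes \<open>a\<close>.
\<close>

section \<open>Truncated powers and increments at infinity\<close>

definition ppow :: "real \<Rightarrow> real \<Rightarrow> real" where
  "ppow s t = max 0 t powr s"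

lemma ppow_pos [simp]: "t > 0 \<Longrightarrow> ppow s t = t powr s"
  by (simp add: ppow_def)

lemma ppow_nonpos [simp]: "t \<le> 0 \<Longrightarrow> ppow s t = 0"
  by (simp add: ppow_def)

lemma ppow_nonneg [simp]: "ppow s t \<ge> 0"
  by (simp add: ppow_def)

lemma ppow_mono: "s \<ge> 0 \<Longrightarrow> t \<le> t' \<Longrightarrow> ppow s t \<le> ppow s t'"
  unfolding ppow_def by (rule powr_mono2) auto

lemma ppow_mult: "r > 0 \<Longrightarrow> ppow s (r * t) = r powr s * ppow s t"
  by (cases "t > 0") (auto simp: powr_mult mult_le_0_iff)

lemma continuous_on_ppow [continuous_intros]:
  assumes "s > 0" "continuous_on A f"
  shows "continuous_on A (\<lambda>x. ppow s (f x))"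
  unfolding ppow_def using assms
  by (intro continuous_on_powr' continuous_intros) auto

lemma measurable_ppow [measurable]: "ppow s \<in> borel_measurable borel"
  unfolding ppow_def[abs_def] by measurable

lemma power2_powr: "v > 0 \<Longrightarrow> (v\<^sup>2) powr s = v powr (2 * s)" for v :: real
  by (metis powr_powr powr_realpow of_nat_numeral)

text \<open>By the mean value theorem the increment is \<open>d\<close> times a value of
  \<open>H'\<close> at a point beyond \<open>x\<close>. It lets the endpoints of primitives be moved
  by a fixed amount at infinity.\<close>

lemma tendsto_increment_zero:
  fixes H H' :: "real \<Rightarrow> real"
  assumes der: "\<And>x. x > M \<Longrightarrow> (H has_real_derivative H' x) (at x)"
    and lim: "(H' \<longlongrightarrow> 0) at_top" and d: "d \<ge> 0"
  shows "((\<lambda>x. H (x + d) - H x) \<longlongrightarrow> 0) at_top"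
proof (cases "d = 0")
  case False
  with d have d: "d > 0" by simp
  show ?thesis
  proof (rule tendstoI)
    fix e :: real assume e: "e > 0"
    with d have "e / d > 0" by simp
    from tendstoD[OF lim this] obtain N where N: "\<And>x. x \<ge> N \<Longrightarrow> \<bar>H' x\<bar> < e / d"
      by (auto simp: eventually_at_top_linorder)
    have "dist (H (x + d) - H x) 0 < e" if x: "x \<ge> max N (M + 1)" for x
    proof -
      obtain z where z: "z > x" "H (x + d) - H x = (x + d - x) * H' z"
        using MVT2[of x "x + d" H H'] der d x by force
      with N[of z] x d show ?thesis
        by (simp add: abs_mult pos_less_divide_eq mult.commute)
    qed
    then show "\<forall>\<^sub>F x in at_top. dist (H (x + d) - H x) 0 < e"
      unfolding eventually_at_top_linorder by blast
  qed
qed simp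

section \<open>The one-dimensional integral along a line through \<open>x\<close>\<close>

definition chord_kernel :: "real \<Rightarrow> (real \<Rightarrow> real) \<Rightarrow> real \<Rightarrow> real" where
  "chord_kernel s k v = ppow s (k v) / v"

text \<open>Since \<open>k 0 < 0\<close>, the truncated power vanishes near 0, so the denominator
  \<open>v\<close> may be replaced there by a positive constant: the kernel has no singularity and
  the fundamental theorem of calculus applies.\<close>

lemma chord_kernel_antiderivative:
  assumes s: "s > 0" and k: "continuous_on UNIV k" "k 0 < 0"
  shows "continuous_on {0..} (chord_kernel s k)"
    and "\<And>B. continuous_on {0..B} (\<lambda>V. integral {0..V} (chord_kernel s k))"
    and "\<And>V. V > 0 \<Longrightarrow> ((\<lambda>V. integral {0..V} (chord_kernel s k)) has_real_derivative chord_kernel s k V) (at V)"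
proof -
  have "open {x. k x < 0}"
    using k(1) by (simp add: open_Collect_less)
  then obtain \<eta> where \<eta>: "\<eta> > 0" "\<And>x. \<bar>x\<bar> < \<eta> \<Longrightarrow> k x < 0"
    using k(2) unfolding open_dist by (auto simp: dist_real_def)
  have eq: "chord_kernel s k v = ppow s (k v) / max v \<eta>" if "v \<ge> 0" for v
    using \<eta>(2)[of v] that by (cases "v < \<eta>") (auto simp: chord_kernel_def max_def)
  show c: "continuous_on {0..} (chord_kernel s k)"
  proof (subst continuous_on_cong[OF refl eq])
    show "continuous_on {0..} (\<lambda>v. ppow s (k v) / max v \<eta>)"
      using s \<eta>(1) by (intro continuous_intros continuous_on_subset[OF k(1)]) auto
  qed simp_all
  have der: "((\<lambda>V. integral {0..V} (chord_kernel s k)) has_real_derivative chord_kernel s k V) (at V within {0..B})"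
    if "V \<in> {0..B}" for V B
    by (rule integral_has_real_derivative[OF _ that]) (rule continuous_on_subset[OF c], auto)
  show "((\<lambda>V. integral {0..V} (chord_kernel s k)) has_real_derivative chord_kernel s k V) (at V)" if "V > 0" for V
    using der[of V "V + 1"] that at_within_Icc_at[of 0 V "V+1"] by simp
  show "continuous_on {0..B} (\<lambda>V. integral {0..V} (chord_kernel s k))" for B
    by (intro indefinite_integral_continuous_1 integrable_continuous_interval
        continuous_on_subset[OF c]) auto
qed

definition chord_primitive :: "real \<Rightarrow> (real \<Rightarrow> real) \<Rightarrow> real \<Rightarrow> real" where
  "chord_primitive s k V = integral {0..V} (chord_kernel s k)"

text \<open>With \<open>a\<close>, \<open>b\<close>, \<open>c\<close> as in the overview, this is
  \<open>v\<^sup>2\<close> times the value of \<open>R - norm z ^ 2\<close> at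
  \<open>z = x + y / v\<close>; the sign of \<open>b\<close> selects \<open>x + y / v\<close> or
  \<open>x - y / v\<close>.\<close>

definition chord_quad :: "real \<Rightarrow> real \<Rightarrow> real \<Rightarrow> real \<Rightarrow> real" where
  "chord_quad a c b v = a * v\<^sup>2 - 2 * b * v - c"

definition chord_integrand :: "real \<Rightarrow> real \<Rightarrow> real \<Rightarrow> real \<Rightarrow> real \<Rightarrow> real" where
  "chord_integrand s a c b v = (2 * a powr s * v powr (2 * s) - ppow s (chord_quad a c b v) - ppow s (chord_quad a c (- b) v)) / v"

context
  fixes s a c :: real
  assumes s: "0 < s" "s < 1" and a: "a > 0" and c: "c > 0"
begin

lemma quad_props: "continuous_on UNIV (chord_quad a c b)" "chord_quad a c b 0 < 0"
  using c unfolding chord_quad_def by (auto intro!: continuous_intros)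

lemma affine_props: "continuous_on UNIV (\<lambda>r. r - c)" "(\<lambda>r. r - c) 0 < 0"
  using c by (auto intro!: continuous_intros)

lemmas chord_primitive_quad_cont = chord_kernel_antiderivative(2)[OF s(1) quad_props, folded chord_primitive_def]
lemmas chord_primitive_quad_deriv = chord_kernel_antiderivative(3)[OF s(1) quad_props, folded chord_primitive_def]
lemmas chord_primitive_affine_cont = chord_kernel_antiderivative(2)[OF s(1) affine_props, folded chord_primitive_def]
lemmas chord_primitive_affine_deriv = chord_kernel_antiderivative(3)[OF s(1) affine_props, folded chord_primitive_def]

text \<open>
  With \<open>\<beta> = b / a\<close> the factorisations \<open>a v\<^sup>2 - 2 b v = a v (v - 2 \<beta>)\<close> and
  \<open>a w\<^sup>2 + 2 b w = a w (w + 2 \<beta>)\<close> agree for \<open>w = v - 2 \<beta>\<close>, and for \<open>q = a v w\<close>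
  one has \<open>dv / v + dw / w = dq / q\<close>: this removes \<open>b\<close>.
\<close>

lemma chord_primitive_sum:
  assumes b: "b \<ge> 0" and V: "V \<ge> b / a"
  shows "chord_primitive s (chord_quad a c b) (V + b / a) + chord_primitive s (chord_quad a c (- b)) (V - b / a)
           = chord_primitive s (\<lambda>r. r - c) (a * V\<^sup>2 - b\<^sup>2 / a)"
proof -
  define \<beta> where "\<beta> = b / a"
  have \<beta>: "\<beta> \<ge> 0" "b = a * \<beta>" using a b by (auto simp: \<beta>_def)
  \<comment> \<open>\<open>V\<close> is the midpoint of \<open>v = V + \<beta>\<close> and
    \<open>w = V - \<beta>\<close>, so \<open>q = a * (V\<^sup>2 - \<beta>\<^sup>2)\<close>.
    \<open>S\<close> has derivative 0 beyond \<open>\<beta>\<close>, and it remains to see that it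
    vanishes at \<open>\<beta>\<close>.\<close>
  define S where "S V = chord_primitive s (chord_quad a c b) (V + \<beta>) + chord_primitive s (chord_quad a c (- b)) (V - \<beta>)
    - chord_primitive s (\<lambda>r. r - c) (a * (V\<^sup>2 - \<beta>\<^sup>2))" for V
  have der: "(S has_real_derivative 0) (at V)" if V: "V > \<beta>" for V
  proof -
    have pos: "V\<^sup>2 - \<beta>\<^sup>2 > 0" "V + \<beta> > 0" "V - \<beta> > 0" using V \<beta>
      by (auto simp: power_strict_mono)
    have "(S has_real_derivative chord_kernel s (chord_quad a c b) (V + \<beta>) * 1 + chord_kernel s (chord_quad a c (- b)) (V - \<beta>) * 1
       - chord_kernel s (\<lambda>r. r - c) (a * (V\<^sup>2 - \<beta>\<^sup>2)) * (a * (2 * V))) (at V)"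
      unfolding S_def using pos a
      by (auto intro!: derivative_eq_intros DERIV_chain2[OF chord_primitive_quad_deriv] DERIV_chain2[OF chord_primitive_affine_deriv])
    moreover have "chord_quad a c b (V + \<beta>) = a * (V\<^sup>2 - \<beta>\<^sup>2) - c" "chord_quad a c (- b) (V - \<beta>) = a * (V\<^sup>2 - \<beta>\<^sup>2) - c"
      using \<beta>(2) by (auto simp: chord_quad_def power2_eq_square algebra_simps)
    moreover have "P / (V + \<beta>) * 1 + P / (V - \<beta>) * 1 - P / (a * (V\<^sup>2 - \<beta>\<^sup>2)) * (a * (2 * V)) = 0" for P
    proof -
      have "P / (V + \<beta>) + P / (V - \<beta>) = P * (2 * V) / ((V + \<beta>) * (V - \<beta>))"
        using pos by (simp add: divide_simps) (simp add: algebra_simps)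
      also have "(V + \<beta>) * (V - \<beta>) = V\<^sup>2 - \<beta>\<^sup>2" by (simp add: power2_eq_square algebra_simps)
      finally show ?thesis using a pos by simp
    qed
    ultimately show ?thesis by (simp add: chord_kernel_def)
  qed
  have cont: "continuous_on {\<beta>..B} S" for B
    unfolding S_def using \<beta> a
    by (intro continuous_intros continuous_on_compose2[OF chord_primitive_quad_cont[of "B + \<beta>"]]
      continuous_on_compose2[OF chord_primitive_quad_cont[of B]] continuous_on_compose2[OF chord_primitive_affine_cont[of "a * (B\<^sup>2 - \<beta>\<^sup>2)"]])
      (auto intro!: mult_left_mono power_mono)
  \<comment> \<open>At \<open>V = \<beta>\<close> the other two primitives run over a single point,
    and this one runs between the roots of \<open>a * v * (v - 2 * \<beta>)\<close>, where the
    truncated power is 0.\<close>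
  have "chord_primitive s (chord_quad a c b) (\<beta> + \<beta>) = integral {0..\<beta> + \<beta>} (\<lambda>_. 0)"
    unfolding chord_primitive_def
  proof (rule integral_cong)
    fix v assume v: "v \<in> {0..\<beta> + \<beta>}"
    have "chord_quad a c b v = a * v * (v - 2 * \<beta>) - c" using \<beta>(2) by (simp add: chord_quad_def power2_eq_square algebra_simps)
    also have "\<dots> \<le> 0" using v a c by (smt (verit) mult_nonneg_nonpos mult_nonneg_nonneg atLeastAtMost_iff)
    finally show "chord_kernel s (chord_quad a c b) v = 0" by (simp add: chord_kernel_def)
  qed
  then have S\<beta>: "S \<beta> = 0" by (simp add: S_def chord_primitive_def)
  have "S V = S \<beta>"
  proof (cases "V = \<beta>")
    case False
    then have "\<beta> < V" using V by (simp add: \<beta>_def)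
    then show ?thesis using DERIV_isconst2[of \<beta> V S V] cont der by auto
  qed simp
  moreover have "a * (V\<^sup>2 - \<beta>\<^sup>2) = a * V\<^sup>2 - b\<^sup>2 / a" using \<beta>(2) a by (simp add: power2_eq_square algebra_simps)
  ultimately show ?thesis using S\<beta> by (simp add: S_def \<beta>_def)
qed

lemma chord_kernel_affine_tendsto: "(chord_kernel s (\<lambda>r. r - c) \<longlongrightarrow> 0) at_top"
proof -
  have "((\<lambda>r. (r - c) powr s / r) \<longlongrightarrow> 0) at_top" using s c by real_asymp
  moreover have "\<forall>\<^sub>F r in at_top. (r - c) powr s / r = chord_kernel s (\<lambda>r. r - c) r"
    using eventually_gt_at_top[of c] by eventually_elim (simp add: chord_kernel_def)
  ultimately show ?thesis by (rule Lim_transform_eventually)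
qed

text \<open>Pulling out \<open>v\<^sup>2\<close> turns the kernel into
  \<open>v powr (2 * s - 1) * f (1 / v)\<close> with \<open>f\<close> differentiable at 0. Hence the
  error after the leading term is of order \<open>v powr (2 * s - 2)\<close>, and
  \<open>s < 1\<close>. For \<open>s >= 1 / 2\<close> the leading term itself does not tend to
  0.\<close>

lemma chord_kernel_quad_asymp: "((\<lambda>v. chord_kernel s (chord_quad a c b) v - a powr s * v powr (2 * s - 1)) \<longlongrightarrow> 0) at_top"
proof -
  define f where "f h = (a - 2 * b * h - c * h\<^sup>2) powr s" for h
  have "(f has_real_derivative (s * a powr (s - 1) * (- 2 * b))) (at 0)"
    unfolding f_def using a by (auto intro!: derivative_eq_intros)
  then have "((\<lambda>h. (f h - f 0) / h) \<longlongrightarrow> s * a powr (s - 1) * (- 2 * b)) (at 0)"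
    by (simp add: DERIV_def)
  moreover have "filterlim (\<lambda>v::real. 1 / v) (at 0) at_top" by real_asymp
  ultimately have "((\<lambda>v. (f (1 / v) - f 0) / (1 / v)) \<longlongrightarrow> s * a powr (s - 1) * (- 2 * b)) at_top"
    by (rule filterlim_compose)
  moreover have "((\<lambda>v. v powr (2 * s - 2)) \<longlongrightarrow> 0) at_top" using s by real_asymp
  ultimately have "((\<lambda>v. v powr (2 * s - 2) * ((f (1 / v) - f 0) / (1 / v))) \<longlongrightarrow> 0 * (s * a powr (s - 1) * (- 2 * b))) at_top"
    by (intro tendsto_mult)
  then have "((\<lambda>v. v powr (2 * s - 2) * ((f (1 / v) - f 0) / (1 / v))) \<longlongrightarrow> 0) at_top" by simp
  moreover have "\<forall>\<^sub>F v in at_top. a - 2 * b * (1 / v) - c * (1 / v)\<^sup>2 > 0" using a by real_asymp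
  then have "\<forall>\<^sub>F v in at_top. v powr (2 * s - 2) * ((f (1 / v) - f 0) / (1 / v))
      = chord_kernel s (chord_quad a c b) v - a powr s * v powr (2 * s - 1)"
    using eventually_gt_at_top[of 0]
  proof eventually_elim
    case (elim v)
    have q: "chord_quad a c b v = v\<^sup>2 * (a - 2 * b * (1 / v) - c * (1 / v)\<^sup>2)"
      using elim by (simp add: chord_quad_def field_simps power2_eq_square)
    have v2: "v\<^sup>2 powr s = v powr (2 * s)" using elim
      by (simp add: power2_powr)
    have "chord_kernel s (chord_quad a c b) v = v powr (2 * s) * f (1 / v) / v"
      using elim unfolding chord_kernel_def q f_def v2[symmetric] by (subst ppow_mult) auto
    moreover have "v powr (2 * s - 1) = v powr (2 * s) / v" "v powr (2 * s - 2) = v powr (2 * s) / v\<^sup>2"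
      using elim by (auto simp: powr_diff)
    moreover have "f 0 = a powr s" by (simp add: f_def)
    ultimately have A: "v powr (2 * s - 2) * ((f (1 / v) - f 0) / (1 / v))
      = v powr (2 * s) / v\<^sup>2 * ((f (1 / v) - a powr s) * v)"
      and B: "chord_kernel s (chord_quad a c b) v - a powr s * v powr (2 * s - 1) = v powr (2 * s) * f (1 / v) / v - a powr s * (v powr (2 * s) / v)"
      by simp_all
    show ?case unfolding A B using elim by (simp add: field_simps power2_eq_square)
  qed
  ultimately show ?thesis by (rule Lim_transform_eventually)
qed

text \<open>The two leading terms differ by an increment of \<open>V powr (2 * s - 1)\<close>, whose
  derivative tends to 0. The difference considered is the derivative of \<open>H\<close> in the next
  lemma.\<close>

lemma chord_kernel_quad_diff_tendsto:
  assumes b: "b \<ge> 0"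
  shows "((\<lambda>V. chord_kernel s (chord_quad a c b) (V + b / a) - chord_kernel s (chord_quad a c (- b)) V) \<longlongrightarrow> 0) at_top"
proof -
  have inc: "((\<lambda>V. (V + b / a) powr (2 * s - 1) - V powr (2 * s - 1)) \<longlongrightarrow> 0) at_top"
  proof (rule tendsto_increment_zero[where M = 0])
    show "((\<lambda>x. x powr (2 * s - 1)) has_real_derivative (2 * s - 1) * x powr (2 * s - 2)) (at x)" if "x > 0" for x
      using that by (auto intro!: derivative_eq_intros)
    have "((\<lambda>v. v powr (2 * s - 2)) \<longlongrightarrow> 0) at_top" using s by real_asymp
    from tendsto_mult_left[OF this, of "2 * s - 1"]
    show "((\<lambda>v. (2 * s - 1) * v powr (2 * s - 2)) \<longlongrightarrow> 0) at_top" by simp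
  qed (use a b in auto)
  have "filterlim (\<lambda>V. V + b / a) at_top at_top" by real_asymp
  from filterlim_compose[OF chord_kernel_quad_asymp this]
  have "((\<lambda>V. (chord_kernel s (chord_quad a c b) (V + b / a) - a powr s * (V + b / a) powr (2 * s - 1))
     - (chord_kernel s (chord_quad a c (- b)) V - a powr s * V powr (2 * s - 1))
     + a powr s * ((V + b / a) powr (2 * s - 1) - V powr (2 * s - 1))) \<longlongrightarrow> 0 - 0 + a powr s * 0) at_top"
    by (intro tendsto_intros inc chord_kernel_quad_asymp)
  then show ?thesis by (simp add: algebra_simps)
qed

text \<open>The exact identity \<open>chord_primitive_sum\<close> has endpoints
  \<open>V + b / a\<close> and \<open>V - b / a\<close>; a common cutoff \<open>V\<close> is needed.
  Moving one endpoint alone may cost an unbounded amount when \<open>s > 1 / 2\<close>, but the two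
  leading contributions cancel.\<close>

lemma chord_primitive_asymp:
  assumes b: "b \<ge> 0"
  shows "((\<lambda>V. chord_primitive s (\<lambda>r. r - c) (a * V\<^sup>2) - chord_primitive s (chord_quad a c b) V - chord_primitive s (chord_quad a c (- b)) V) \<longlongrightarrow> 0) at_top"
proof -
  let ?F = "chord_primitive s (\<lambda>r. r - c)"
  have 1: "((\<lambda>q. ?F (q + b\<^sup>2 / a) - ?F q) \<longlongrightarrow> 0) at_top"
    by (rule tendsto_increment_zero[OF chord_primitive_affine_deriv chord_kernel_affine_tendsto]) (use a in auto)
  have "filterlim (\<lambda>V. a * V\<^sup>2 - b\<^sup>2 / a) at_top at_top" using a by real_asymp
  from filterlim_compose[OF 1 this]
  have 1: "((\<lambda>V. ?F (a * V\<^sup>2) - ?F (a * V\<^sup>2 - b\<^sup>2 / a)) \<longlongrightarrow> 0) at_top" by simp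
  \<comment> \<open>\<open>H V - H (V - b / a)\<close> is exactly the joint error of moving both
    endpoints to \<open>V\<close>, and \<open>H'\<close> tends to 0 although its two terms
    separately need not.\<close>
  define H where "H V = chord_primitive s (chord_quad a c b) (V + b / a) - chord_primitive s (chord_quad a c (- b)) V" for V
  have 2: "((\<lambda>V. H (V + b / a) - H V) \<longlongrightarrow> 0) at_top"
  proof (rule tendsto_increment_zero[OF _ chord_kernel_quad_diff_tendsto[OF b]])
    fix V :: real assume "V > 0"
    moreover from this have "V + b / a > 0" using a b by (simp add: add_pos_nonneg)
    ultimately show "(H has_real_derivative chord_kernel s (chord_quad a c b) (V + b / a) - chord_kernel s (chord_quad a c (- b)) V) (at V)"
      unfolding H_def by (auto intro!: derivative_eq_intros DERIV_chain2[OF chord_primitive_quad_deriv])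
  qed (use a b in auto)
  have "filterlim (\<lambda>V. V - b / a) at_top at_top" by real_asymp
  from filterlim_compose[OF 2 this]
  have 2: "((\<lambda>V. H V - H (V - b / a)) \<longlongrightarrow> 0) at_top" by simp
  from tendsto_add[OF 1 2]
  have "((\<lambda>V. ?F (a * V\<^sup>2) - ?F (a * V\<^sup>2 - b\<^sup>2 / a) + (H V - H (V - b / a))) \<longlongrightarrow> 0) at_top" by simp
  moreover have "\<forall>\<^sub>F V in at_top. ?F (a * V\<^sup>2) - ?F (a * V\<^sup>2 - b\<^sup>2 / a) + (H V - H (V - b / a))
     = ?F (a * V\<^sup>2) - chord_primitive s (chord_quad a c b) V - chord_primitive s (chord_quad a c (- b)) V"
    using eventually_ge_at_top[of "b / a"]
  proof eventually_elim
    case (elim V)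
    from chord_primitive_sum[OF b elim] show ?case by (simp add: H_def)
  qed
  ultimately show ?thesis by (rule Lim_transform_eventually)
qed

text \<open>The integral up to a cutoff \<open>V\<close> is an explicit \<open>\<Psi> V\<close>.
  Replacing the two quadratic primitives by the affine one at \<open>a * V\<^sup>2\<close> removes
  \<open>b\<close>, and the substitution \<open>V = W / sqrt a\<close> then removes
  \<open>a\<close>.\<close>

lemma tendsto_integral_chord_integrand:
  assumes b: "b \<ge> 0" and int: "set_integrable lborel {0<..} (chord_integrand s a c b)"
  shows "((\<lambda>W. W powr (2 * s) / s - chord_primitive s (\<lambda>r. r - c) (W\<^sup>2)) \<longlongrightarrow> (LINT v:{0<..}|lborel. chord_integrand s a c b v)) at_top"
proof -
  let ?F = "chord_primitive s (\<lambda>r. r - c)" and ?I = "LINT v:{0<..}|lborel. chord_integrand s a c b v"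
  define \<Psi> where "\<Psi> V = a powr s * V powr (2 * s) / s - chord_primitive s (chord_quad a c b) V - chord_primitive s (chord_quad a c (- b)) V" for V
  \<comment> \<open>At 0 only continuity of \<open>\<Psi>\<close> is used: for
    \<open>s < 1 / 2\<close> the integrand is unbounded near 0.\<close>
  have FTC: "(chord_integrand s a c b has_integral (\<Psi> V - \<Psi> 0)) {0..V}" if elim: "V \<ge> 0" for V
  proof (rule fundamental_theorem_of_calculus_interior)
    show "continuous_on {0..V} \<Psi>" unfolding \<Psi>_def using s
      by (intro continuous_intros continuous_on_powr' chord_primitive_quad_cont) auto
    fix v assume v: "v \<in> {0<..<V}"
    then have "((\<lambda>v. v powr (2 * s)) has_real_derivative (2 * s) * v powr (2 * s - 1)) (at v)"
      by (intro has_real_derivative_powr) auto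
    from DERIV_cdivide[OF DERIV_cmult[OF this, of "a powr s"], of s]
    have "(\<Psi> has_real_derivative a powr s * ((2 * s) * v powr (2 * s - 1)) / s - chord_kernel s (chord_quad a c b) v - chord_kernel s (chord_quad a c (- b)) v) (at v)"
      unfolding \<Psi>_def by (rule DERIV_diff[OF DERIV_diff]) (use v in \<open>auto intro!: chord_primitive_quad_deriv\<close>)
    moreover have "a powr s * ((2 * s) * v powr (2 * s - 1)) / s - chord_kernel s (chord_quad a c b) v - chord_kernel s (chord_quad a c (- b)) v = chord_integrand s a c b v"
      using v s by (simp add: chord_integrand_def chord_kernel_def powr_diff diff_divide_distrib)
    ultimately show "(\<Psi> has_vector_derivative chord_integrand s a c b v) (at v)"
      by (simp add: has_real_derivative_iff_has_vector_derivative)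
  qed (use elim in auto)
  have "((\<lambda>V. LINT v|lborel. indicator {..V} v *\<^sub>R (indicator {0<..} v *\<^sub>R chord_integrand s a c b v)) \<longlongrightarrow> ?I) at_top"
    unfolding set_lebesgue_integral_def
    by (rule tendsto_integral_at_top) (use int in \<open>auto simp: set_integrable_def\<close>)
  moreover have "\<forall>\<^sub>F V in at_top. (LINT v|lborel. indicator {..V} v *\<^sub>R (indicator {0<..} v *\<^sub>R chord_integrand s a c b v)) = \<Psi> V"
    using eventually_ge_at_top[of 0]
  proof eventually_elim
    case (elim V)
    have "(LINT v|lborel. indicator {..V} v *\<^sub>R (indicator {0<..} v *\<^sub>R chord_integrand s a c b v)) = (LINT v:{0<..V}|lborel. chord_integrand s a c b v)"
      unfolding set_lebesgue_integral_def by (intro Bochner_Integration.integral_cong) (auto simp: indicator_def)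
    also have "\<dots> = integral {0<..V} (chord_integrand s a c b)"
      by (rule set_borel_integral_eq_integral(2), rule set_integrable_subset[OF int]) auto
    also have "\<dots> = integral {0..V} (chord_integrand s a c b)"
    proof (rule integral_spike_set)
      show "negligible {v \<in> {0<..V} - {0..V}. chord_integrand s a c b v \<noteq> 0}" by (rule negligible_subset[OF negligible_sing[of 0]]) auto
      show "negligible {v \<in> {0..V} - {0<..V}. chord_integrand s a c b v \<noteq> 0}" by (rule negligible_subset[OF negligible_sing[of 0]]) auto
    qed
    also have "\<dots> = \<Psi> V - \<Psi> 0"
      by (rule integral_unique[OF FTC[OF elim]])
    finally show ?case by (simp add: \<Psi>_def chord_primitive_def)
  qed
  ultimately have "(\<Psi> \<longlongrightarrow> ?I) at_top" by (rule Lim_transform_eventually)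
  from tendsto_diff[OF this chord_primitive_asymp[OF b]]
  have lim: "((\<lambda>V. a powr s * V powr (2 * s) / s - ?F (a * V\<^sup>2)) \<longlongrightarrow> ?I) at_top"
    by (simp add: \<Psi>_def)
  have "filterlim (\<lambda>W. W / sqrt a) at_top at_top" using a by real_asymp
  from filterlim_compose[OF lim this]
  have "((\<lambda>W. a powr s * (W / sqrt a) powr (2 * s) / s - ?F (a * (W / sqrt a)\<^sup>2)) \<longlongrightarrow> ?I) at_top" .
  moreover have "\<forall>\<^sub>F W in at_top. a powr s * (W / sqrt a) powr (2 * s) / s - ?F (a * (W / sqrt a)\<^sup>2)
     = W powr (2 * s) / s - ?F (W\<^sup>2)"
    using eventually_gt_at_top[of 0]
  proof eventually_elim
    case (elim W)
    have "sqrt a powr (2 * s) = a powr s"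
      using a by (simp add: powr_half_sqrt[symmetric] powr_powr)
    then show ?case using elim a by (simp add: powr_divide power_divide)
  qed
  ultimately show ?thesis by (rule Lim_transform_eventually)
qed

lemma chord_integrand_minus: "chord_integrand s a c (- b) = chord_integrand s a c b"
  by (auto simp: chord_integrand_def)

text \<open>The integrand is even in \<open>b\<close>, so a negative \<open>b\<close> is handled
  through \<open>- b\<close>.\<close>

lemma integral_chord_integrand:
  assumes "set_integrable lborel {0<..} (chord_integrand s a c b)"
  shows "(LINT v:{0<..}|lborel. chord_integrand s a c b v) = Lim at_top (\<lambda>W. W powr (2 * s) / s - chord_primitive s (\<lambda>r. r - c) (W\<^sup>2))"
  using tendsto_Lim[OF _ tendsto_integral_chord_integrand[of b]] tendsto_Lim[OF _ tendsto_integral_chord_integrand[of "- b"]] assms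
  by (cases "b \<ge> 0") (auto simp: chord_integrand_minus)

end

section \<open>Polar coordinates through dilations\<close>

definition dilation_weight :: "'a::euclidean_space \<times> real \<Rightarrow> real" where
  "dilation_weight p = indicator {1..2} (norm (fst p)) * indicator {0<..} (snd p) / snd p ^ Suc DIM('a)"

lemma measurable_dilation_weight [measurable]: "dilation_weight \<in> borel_measurable (lborel \<Otimes>\<^sub>M lborel)"
  unfolding dilation_weight_def[abs_def] by measurable

lemma dilation_weight_nonneg [simp]: "dilation_weight p \<ge> 0"
  by (auto simp: dilation_weight_def indicator_def)

text \<open>The Jacobian of \<open>y = v z\<close> cancels all but one power of \<open>v\<close> in
  \<open>dilation_weight\<close>, leaving \<open>dv / v\<close>. This measure is dilation invariant:
  the interval from \<open>1 / r\<close> to \<open>2 / r\<close> has mass \<open>ln 2\<close> for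
  every \<open>r\<close>.\<close>

lemma nn_integral_log_annulus:
  assumes "r > 0"
  shows "(\<integral>\<^sup>+v. ennreal (indicator {1..2} (v * r) * indicator {0<..} v / v) \<partial>lborel) = ennreal (ln 2)"
proof -
  have "((\<lambda>v. 1 / v) has_integral ln (2 / r) - ln (1 / r)) {1 / r..2 / r}"
  proof (rule fundamental_theorem_of_calculus)
    fix v assume "v \<in> {1 / r..2 / r}"
    then have "v > 0" using assms by (simp add: less_le_trans[of 0 "1 / r"])
    then have "(ln has_real_derivative 1 / v) (at v within {1 / r..2 / r})"
      by (rule DERIV_subset[OF DERIV_ln_divide]) simp
    then show "(ln has_vector_derivative 1 / v) (at v within {1 / r..2 / r})"
      by (simp add: has_real_derivative_iff_has_vector_derivative)
  qed (use assms in \<open>simp add: divide_right_mono\<close>)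
  moreover have "ln (2 / r) - ln (1 / r) = ln 2" using assms by (simp add: ln_div)
  ultimately have "((\<lambda>v. if v \<in> {1 / r..2 / r} then 1 / v else 0) has_integral ln 2) UNIV"
    by (simp only: has_integral_restrict_UNIV)
  moreover have "(\<lambda>v. if v \<in> {1 / r..2 / r} then 1 / v else 0)
     = (\<lambda>v. indicator {1..2} (v * r) * indicator {0<..} v / v)"
    using assms by (auto simp: indicator_def field_simps fun_eq_iff) (smt (verit) mult_nonpos_nonneg)
  ultimately have "((\<lambda>v. indicator {1..2} (v * r) * indicator {0<..} v / v) has_integral ln 2) UNIV"
    by simp
  then show ?thesis
    by (intro nn_integral_has_integral_lborel) (auto simp: indicator_def)
qed

text \<open>
  A substitute for polar coordinates: the point \<open>z = y / v\<close> is parametrised by \<open>y\<close> in the annulus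
  \<open>1 \<le> norm y \<le> 2\<close> and by the inverse radius \<open>v > 0\<close>, so only the scaling of Lebesgue measure is needed.
\<close>

lemma nn_integral_dilation:
  fixes g :: "'a::euclidean_space \<Rightarrow> ennreal"
  assumes [measurable]: "g \<in> borel_measurable borel"
  shows "(\<integral>\<^sup>+p. ennreal (dilation_weight p) * g (fst p /\<^sub>R snd p) \<partial>(lborel \<Otimes>\<^sub>M lborel))
           = ennreal (ln 2) * (\<integral>\<^sup>+z. g z \<partial>lborel)"
proof -
  have "(\<integral>\<^sup>+p. ennreal (dilation_weight p) * g (fst p /\<^sub>R snd p) \<partial>(lborel \<Otimes>\<^sub>M lborel))
     = (\<integral>\<^sup>+v. \<integral>\<^sup>+y. ennreal (dilation_weight (y, v)) * g (y /\<^sub>R v) \<partial>lborel \<partial>lborel)"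
    by (subst lborel_pair.nn_integral_snd[symmetric]) auto
  also have "\<dots> = (\<integral>\<^sup>+v. \<integral>\<^sup>+z. ennreal (indicator {1..2} (v * norm z) * indicator {0<..} v / v) * g z \<partial>lborel \<partial>lborel)"
  proof (rule nn_integral_cong)
    fix v :: real
    show "(\<integral>\<^sup>+y. ennreal (dilation_weight (y, v)) * g (y /\<^sub>R v) \<partial>lborel)
      = (\<integral>\<^sup>+z. ennreal (indicator {1..2} (v * norm z) * indicator {0<..} v / v) * g z \<partial>lborel)"
    proof (cases "v > 0")
      case True
      have "(\<integral>\<^sup>+y. ennreal (dilation_weight (y, v)) * g (y /\<^sub>R v) \<partial>lborel)
        = (\<integral>\<^sup>+z. ennreal (\<bar>v\<bar> ^ DIM('a)) * (ennreal (dilation_weight (v *\<^sub>R z, v)) * g ((v *\<^sub>R z) /\<^sub>R v)) \<partial>lborel)"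
        using True by (subst lborel_affine[of v 0]) (simp_all add: nn_integral_density nn_integral_distr)
      also have "\<dots> = (\<integral>\<^sup>+z. ennreal (indicator {1..2} (v * norm z) * indicator {0<..} v / v) * g z \<partial>lborel)"
        using True by (intro nn_integral_cong) (simp add: mult.assoc[symmetric] ennreal_mult[symmetric] dilation_weight_def)
      finally show ?thesis .
    qed (simp add: dilation_weight_def)
  qed
  also have "\<dots> = (\<integral>\<^sup>+z. \<integral>\<^sup>+v. ennreal (indicator {1..2} (v * norm z) * indicator {0<..} v / v) * g z \<partial>lborel \<partial>lborel)"
    by (rule lborel_pair.Fubini') measurable
  also have "\<dots> = (\<integral>\<^sup>+z. ennreal (ln 2) * g z \<partial>lborel)"
  proof (rule nn_integral_cong_AE)
    \<comment> \<open>The origin has to be left out: \<open>v * norm z\<close> never reaches the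
      annulus there, so the inner integral is 0.\<close>
    have "AE z in lborel. z \<noteq> (0::'a)" by (rule AE_lborel_singleton)
    then show "AE z in lborel. (\<integral>\<^sup>+v. ennreal (indicator {1..2} (v * norm z) * indicator {0<..} v / v) * g z \<partial>lborel)
      = ennreal (ln 2) * g z"
      by eventually_elim (simp add: nn_integral_multc nn_integral_log_annulus)
  qed
  also have "\<dots> = ennreal (ln 2) * (\<integral>\<^sup>+z. g z \<partial>lborel)"
    by (rule nn_integral_cmult) simp
  finally show ?thesis .
qed

text \<open>Stated as an equality of measures, the identity for nonnegative integrands transfers to
  integrability and integrals of signed functions.\<close>

lemma dilation_measure:
  "distr (density (lborel \<Otimes>\<^sub>M lborel) (\<lambda>p. ennreal (dilation_weight p))) borel (\<lambda>p. fst p /\<^sub>R snd p)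
     = density (lborel :: 'a::euclidean_space measure) (\<lambda>_. ennreal (ln 2))"
proof (rule measure_eqI)
  fix B :: "'a set"
  assume "B \<in> sets (distr (density (lborel \<Otimes>\<^sub>M lborel) (\<lambda>p. ennreal (dilation_weight p))) borel (\<lambda>p. fst p /\<^sub>R snd p))"
  then have [measurable]: "B \<in> sets borel" by simp
  let ?T = "\<lambda>p::'a \<times> real. fst p /\<^sub>R snd p"
  have "emeasure (distr (density (lborel \<Otimes>\<^sub>M lborel) (\<lambda>p. ennreal (dilation_weight p))) borel ?T) B
    = (\<integral>\<^sup>+z. indicator B z \<partial>distr (density (lborel \<Otimes>\<^sub>M lborel) (\<lambda>p. ennreal (dilation_weight p))) borel ?T)"
    by simp
  also have "\<dots> = (\<integral>\<^sup>+p. ennreal (dilation_weight p) * indicator B (?T p) \<partial>(lborel \<Otimes>\<^sub>M lborel))"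
    by (subst nn_integral_distr) (auto simp: nn_integral_density)
  also have "\<dots> = emeasure (density lborel (\<lambda>_. ennreal (ln 2))) B"
    by (subst nn_integral_dilation) (simp_all add: emeasure_density_const)
  finally show "emeasure (distr (density (lborel \<Otimes>\<^sub>M lborel) (\<lambda>p. ennreal (dilation_weight p))) borel ?T) B
    = emeasure (density lborel (\<lambda>_. ennreal (ln 2))) B" .
qed simp

lemma integrable_dilation_iff:
  fixes f :: "'a::euclidean_space \<Rightarrow> real"
  assumes [measurable]: "f \<in> borel_measurable borel"
  shows "integrable (lborel \<Otimes>\<^sub>M lborel) (\<lambda>p. dilation_weight p * f (fst p /\<^sub>R snd p)) \<longleftrightarrow> integrable lborel f"
proof -
  have "integrable (lborel \<Otimes>\<^sub>M lborel) (\<lambda>p. dilation_weight p * f (fst p /\<^sub>R snd p))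
    \<longleftrightarrow> integrable (distr (density (lborel \<Otimes>\<^sub>M lborel) (\<lambda>p. ennreal (dilation_weight p))) borel (\<lambda>p. fst p /\<^sub>R snd p)) f"
    by (subst integrable_distr_eq) (auto simp: integrable_density)
  also have "\<dots> \<longleftrightarrow> integrable lborel f"
    unfolding dilation_measure by (subst integrable_density) auto
  finally show ?thesis .
qed

lemma integral_dilation:
  fixes f :: "'a::euclidean_space \<Rightarrow> real"
  assumes [measurable]: "f \<in> borel_measurable borel"
  shows "(LINT p|(lborel \<Otimes>\<^sub>M lborel). dilation_weight p * f (fst p /\<^sub>R snd p)) = ln 2 * (LINT z|lborel. f z)"
proof -
  have "(LINT p|(lborel \<Otimes>\<^sub>M lborel). dilation_weight p * f (fst p /\<^sub>R snd p))
    = integral\<^sup>L (distr (density (lborel \<Otimes>\<^sub>M lborel) (\<lambda>p. ennreal (dilation_weight p))) borel (\<lambda>p. fst p /\<^sub>R snd p)) f"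
    by (subst integral_distr) (auto simp: integral_density)
  also have "\<dots> = ln 2 * (LINT z|lborel. f z)"
    unfolding dilation_measure by (subst integral_density) auto
  finally show ?thesis .
qed

text \<open>In the inverse radius \<open>v\<close>, infinity corresponds to \<open>v\<close> near 0,
  with majorant of order \<open>v powr (2 * s - 1)\<close>, and the origin to large
  \<open>v\<close>, with order \<open>v powr (2 * s - 3)\<close>. These are integrable because
  \<open>s > 0\<close> and \<open>s < 1\<close> respectively.\<close>

lemma integrable_min_one_norm_powr:
  fixes s :: real
  assumes s: "0 < s" "s < 1"
  shows "integrable lborel (\<lambda>z::'a::euclidean_space. min 1 ((norm z)\<^sup>2) / norm z powr (real DIM('a) + 2 * s))"
    (is "integrable _ ?f")
proof (rule integrableI_bounded)
  let ?n = "real DIM('a)"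
  show [measurable]: "?f \<in> borel_measurable lborel" by measurable
  \<comment> \<open>On the annulus \<open>norm y <= 2\<close> gives
    \<open>norm (y / v) ^ 2 <= 4 / v\<^sup>2\<close>, whence the factor 4;
    \<open>norm y >= 1\<close> bounds the denominator from below.\<close>
  define k where "k v = 4 * (if v \<le> 1 then v powr (2 * s - 1) else v powr (2 * s - 3))" for v :: real
  have [measurable]: "k \<in> borel_measurable borel" unfolding k_def[abs_def] by measurable
  have k0: "k v \<ge> 0" for v by (simp add: k_def)
  have "(\<integral>\<^sup>+v. ennreal (indicator {0<..} v * k v) \<partial>lborel) < \<infinity>"
  proof -
    have 1: "(\<integral>\<^sup>+v. ennreal (4 * v powr (2 * s - 1)) * indicator {0..1} v \<partial>lborel) < \<infinity>"
      using has_integral_powr_from_0[of "2 * s - 1" 1, THEN has_integral_mult_right, of 4] s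
      by (subst nn_integral_has_integral_lebesgue') auto
    have 2: "(\<integral>\<^sup>+v. ennreal (4 * v powr (2 * s - 3)) * indicator {1..} v \<partial>lborel) < \<infinity>"
    proof (subst nn_integral_FTC_atLeast[where F = "\<lambda>v. 4 * v powr (2 * s - 2) / (2 * s - 2)" and T = 0])
      have "((\<lambda>v. v powr (2 * s - 2)) \<longlongrightarrow> 0) at_top" using s by real_asymp
      from tendsto_mult_left[OF this, of "4 / (2 * s - 2)"]
      show "((\<lambda>v. 4 * v powr (2 * s - 2) / (2 * s - 2)) \<longlongrightarrow> 0) at_top" by simp
      show "((\<lambda>v. 4 * v powr (2 * s - 2) / (2 * s - 2)) has_real_derivative 4 * v powr (2 * s - 3)) (at v)"
        if "1 \<le> v" for v using that s
        by (auto intro!: derivative_eq_intros simp: divide_simps)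
    qed auto
    have "(\<integral>\<^sup>+v. ennreal (indicator {0<..} v * k v) \<partial>lborel)
      \<le> (\<integral>\<^sup>+v. ennreal (4 * v powr (2 * s - 1)) * indicator {0..1} v + ennreal (4 * v powr (2 * s - 3)) * indicator {1..} v \<partial>lborel)"
      by (intro nn_integral_mono) (auto simp: k_def indicator_def)
    also have "\<dots> < \<infinity>" using 1 2 by (subst nn_integral_add) auto
    finally show ?thesis .
  qed
  moreover have "(\<integral>\<^sup>+y. ennreal (indicator {1..2} (norm (y::'a))) \<partial>lborel) < \<infinity>"
  proof -
    have "(\<integral>\<^sup>+y. ennreal (indicator {1..2} (norm (y::'a))) \<partial>lborel) \<le> (\<integral>\<^sup>+y. indicator (cball 0 2) (y::'a) \<partial>lborel)"
      by (intro nn_integral_mono) (auto simp: indicator_def)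
    also have "\<dots> < \<infinity>" using emeasure_bounded_finite[of "cball (0::'a) 2"] by simp
    finally show ?thesis .
  qed
  ultimately have fin: "(\<integral>\<^sup>+y. ennreal (indicator {1..2} (norm (y::'a))) \<partial>lborel) * (\<integral>\<^sup>+v. ennreal (indicator {0<..} v * k v) \<partial>lborel) < \<infinity>"
    by (simp add: ennreal_mult_less_top)
  have bd: "dilation_weight p * norm (?f (fst p /\<^sub>R snd p)) \<le> indicator {1..2} (norm (fst p)) * (indicator {0<..} (snd p) * k (snd p))" for p :: "'a \<times> real"
  proof -
    obtain y v where p: "p = (y, v)" by force
    have "min 1 ((norm (y /\<^sub>R v))\<^sup>2) / norm (y /\<^sub>R v) powr (?n + 2 * s) / v ^ Suc DIM('a) \<le> k v"
      if y: "1 \<le> norm y" "norm y \<le> 2" and v: "v > 0"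
    proof -
      have "norm (y /\<^sub>R v) powr (?n + 2 * s) \<ge> (1 / v) powr (?n + 2 * s)"
        using y v s by (intro powr_mono2) (auto simp: field_simps)
      then have "min 1 ((norm (y /\<^sub>R v))\<^sup>2) / norm (y /\<^sub>R v) powr (?n + 2 * s) / v ^ Suc DIM('a)
        \<le> min 1 ((norm (y /\<^sub>R v))\<^sup>2) / (1 / v) powr (?n + 2 * s) / v ^ Suc DIM('a)"
        using v y by (intro divide_right_mono divide_left_mono) (auto intro!: mult_pos_pos)
      also have "\<dots> = min 1 ((norm (y /\<^sub>R v))\<^sup>2) * v powr (2 * s - 1)"
      proof -
        have "(1 / v) powr (?n + 2 * s) = 1 / (v ^ DIM('a) * v powr (2 * s))"
          using v by (simp add: powr_divide powr_add powr_realpow)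
        moreover have "v powr (2 * s - 1) = v powr (2 * s) / v"
          using v by (simp add: powr_diff)
        ultimately show ?thesis using v by (simp only: power_Suc) simp
      qed
      also have "\<dots> \<le> k v"
      proof (cases "v \<le> 1")
        case True
        have "min 1 ((norm (y /\<^sub>R v))\<^sup>2) * v powr (2 * s - 1) \<le> 4 * v powr (2 * s - 1)"
          by (intro mult_right_mono) auto
        then show ?thesis using True by (simp add: k_def)
      next
        case False
        have "(norm y)\<^sup>2 \<le> 2\<^sup>2" using y by (intro power_mono) auto
        then have "min 1 ((norm (y /\<^sub>R v))\<^sup>2) \<le> 4 / v\<^sup>2"
          using v by (intro min.coboundedI2) (simp add: power_mult_distrib field_simps)
        then have "min 1 ((norm (y /\<^sub>R v))\<^sup>2) * v powr (2 * s - 1) \<le> 4 / v\<^sup>2 * v powr (2 * s - 1)"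
          by (intro mult_right_mono) auto
        also have "\<dots> = 4 * v powr (2 * s - 3)"
          using v by (simp add: powr_diff field_simps power2_eq_square power3_eq_cube)
        finally show ?thesis using False by (simp add: k_def)
      qed
      finally show ?thesis .
    qed
    then show ?thesis by (auto simp: p dilation_weight_def indicator_def mult_ac)
  qed
  have "ennreal (ln 2) * (\<integral>\<^sup>+z. ennreal (norm (?f z)) \<partial>lborel)
    = (\<integral>\<^sup>+p. ennreal (dilation_weight p) * ennreal (norm (?f (fst p /\<^sub>R snd p))) \<partial>(lborel \<Otimes>\<^sub>M lborel))"
    by (rule nn_integral_dilation[symmetric]) measurable
  also have "\<dots> \<le> (\<integral>\<^sup>+p. ennreal (indicator {1..2} (norm (fst p :: 'a))) * ennreal (indicator {0<..} (snd p) * k (snd p)) \<partial>(lborel \<Otimes>\<^sub>M lborel))"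
    using bd k0 by (intro nn_integral_mono) (simp add: ennreal_mult[symmetric] del: norm_divide)
  also have "\<dots> = (\<integral>\<^sup>+y. \<integral>\<^sup>+v. ennreal (indicator {1..2} (norm (y::'a))) * ennreal (indicator {0<..} v * k v) \<partial>lborel \<partial>lborel)"
    by (subst lborel.nn_integral_fst[symmetric]) auto
  also have "\<dots> = (\<integral>\<^sup>+y. ennreal (indicator {1..2} (norm (y::'a))) \<partial>lborel) * (\<integral>\<^sup>+v. ennreal (indicator {0<..} v * k v) \<partial>lborel)"
    by (subst nn_integral_cmult) (auto simp: nn_integral_multc)
  also note fin
  finally show "(\<integral>\<^sup>+z. ennreal (norm (?f z)) \<partial>lborel) < \<infinity>"
    by (auto simp add: ennreal_mult_less_top)
qed

section \<open>Second differences of the bump functions\<close>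

lemma ppow_linearization:
  assumes s: "0 < s" "s < 1" and a: "a > 0" and d: "\<bar>d\<bar> \<le> a / 2"
  shows "\<bar>ppow s (a + d) - a powr s - s * a powr (s - 1) * d\<bar> \<le> s * (1 - s) * (a / 2) powr (s - 2) * d\<^sup>2"
proof -
  define K where "K = s * (1 - s) * (a / 2) powr (s - 2)"
  have K: "K \<ge> 0" using s by (simp add: K_def)
  define S where "S = {- \<bar>d\<bar>..\<bar>d\<bar>}"
  have pos: "a + t \<ge> a / 2" "a + t > 0" if "t \<in> S" for t
    using that d a by (auto simp: S_def)
  \<comment> \<open>\<open>g\<close> is the power without its linear part, so \<open>g'\<close>
    vanishes at 0. On \<open>S\<close> one has \<open>a + t >= a / 2\<close>, which bounds the
    second derivative by \<open>K\<close>; the mean value inequality is applied to \<open>g'\<close>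
    and then to \<open>g\<close>.\<close>
  define g where "g t = (a + t) powr s - s * a powr (s - 1) * t" for t
  define g' where "g' t = s * ((a + t) powr (s - 1) - a powr (s - 1))" for t
  have S: "convex S" "d \<in> S" "0 \<in> S" by (auto simp: S_def)
  have "\<bar>g' t\<bar> \<le> K * \<bar>d\<bar>" if t: "t \<in> S" for t
  proof -
    have "norm (g' t - g' 0) \<le> K * norm (t - 0)"
    proof (rule field_differentiable_bound[OF S(1) _ _ t S(3)])
      fix r assume r: "r \<in> S"
      show "(g' has_field_derivative s * ((s - 1) * (a + r) powr (s - 2))) (at r within S)"
        unfolding g'_def using pos[OF r] by (auto intro!: derivative_eq_intros)
      have "(a + r) powr (s - 2) \<le> (a / 2) powr (s - 2)"
        using pos[OF r] a s by (intro powr_mono2') auto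
      then have "s * (1 - s) * (a + r) powr (s - 2) \<le> K"
        unfolding K_def using s by (intro mult_left_mono) auto
      then show "norm (s * ((s - 1) * (a + r) powr (s - 2))) \<le> K"
        using s by (simp add: abs_mult)
    qed
    also have "\<dots> \<le> K * \<bar>d\<bar>" using t K by (intro mult_left_mono) (auto simp: S_def)
    finally show ?thesis by (simp add: g'_def)
  qed
  then have "norm (g d - g 0) \<le> K * \<bar>d\<bar> * norm (d - 0)"
  proof (intro field_differentiable_bound[OF S(1) _ _ S(2,3)])
    show "(g has_field_derivative g' t) (at t within S)" if "t \<in> S" for t
      unfolding g_def g'_def using pos[OF that]
      by (auto intro!: derivative_eq_intros simp: right_diff_distrib)
  qed simp_all
  then show ?thesis using pos[OF S(2)] by (simp add: g_def K_def power2_eq_square mult.assoc)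
qed

text \<open>Getoor's function, called \<open>h\<close> in the overview; \<open>R\<close> is the
  square of the radius of its support.\<close>

definition bump :: "real \<Rightarrow> real \<Rightarrow> 'a::euclidean_space \<Rightarrow> real" where
  "bump s R x = ppow s (R - x \<bullet> x)"

lemma measurable_bump [measurable]: "bump s R \<in> borel_measurable borel"
  unfolding bump_def[abs_def] by measurable

lemma bump_bounds: "s > 0 \<Longrightarrow> 0 \<le> bump s R x" "s > 0 \<Longrightarrow> R > 0 \<Longrightarrow> bump s R x \<le> R powr s"
  using ppow_mono[of s "R - x \<bullet> x" R] by (auto simp: bump_def)

text \<open>For small \<open>z\<close> the terms linear in \<open>x \<bullet> z\<close> cancel
  between \<open>x + z\<close> and \<open>x - z\<close>, leaving an error quadratic in
  \<open>norm z\<close>; for large \<open>z\<close> boundedness of the bump suffices.\<close>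

lemma bump_second_difference:
  fixes x :: "'a::euclidean_space"
  assumes s: "0 < s" "s < 1" and x: "x \<bullet> x < R"
  obtains C where "\<And>z. \<bar>2 * bump s R x - bump s R (x + z) - bump s R (x - z)\<bar> \<le> C * min 1 ((norm z)\<^sup>2)"
proof -
  define a where "a = R - x \<bullet> x"
  have a: "a > 0" and R: "R > 0" using x by (auto simp: a_def intro: le_less_trans[OF inner_ge_zero])
  \<comment> \<open>For \<open>norm z <= \<delta>\<close> the perturbation of
    \<open>R - x \<bullet> x\<close> is at most \<open>(2 * norm x + 1) * norm z <= a / 2\<close>,
    the range of \<open>ppow_linearization\<close>; \<open>\<delta> <= 1\<close> allows higher
    powers of \<open>norm z\<close> to be absorbed.\<close>
  define \<delta> where "\<delta> = min 1 (a / (2 * (2 * norm x + 1)))"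
  have \<delta>: "0 < \<delta>" "\<delta> \<le> 1" using a by (auto simp: \<delta>_def add_nonneg_pos)
  define K where "K = s * (1 - s) * (a / 2) powr (s - 2)"
  have K: "K \<ge> 0" using s by (simp add: K_def)
  define C1 where "C1 = 2 * K * (4 * (norm x)\<^sup>2 + 1) + 2 * (s * a powr (s - 1))"
  define C2 where "C2 = 2 * R powr s / \<delta>\<^sup>2"
  define D where "D z = 2 * bump s R x - bump s R (x + z) - bump s R (x - z)" for z
  have C: "C1 \<ge> 0" "C2 \<ge> 0" using K s by (auto simp: C1_def C2_def)
  have small: "\<bar>D z\<bar> \<le> C1 * min 1 ((norm z)\<^sup>2)" if z: "norm z \<le> \<delta>" for z
  proof -
    define p q where "p = 2 * (x \<bullet> z)" and "q = (norm z)\<^sup>2"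
    have z1: "norm z \<le> 1" using z \<delta> by simp
    have q: "0 \<le> q" "q \<le> norm z" "q \<le> 1" "q\<^sup>2 \<le> q"
      using z1 by (auto simp: q_def power2_eq_square mult_left_le mult_le_one intro!: mult_left_le)
    have p: "\<bar>p\<bar> \<le> 2 * norm x * norm z" using Cauchy_Schwarz_ineq2[of x z] by (simp add: p_def)
    have p2: "p\<^sup>2 \<le> 4 * (norm x)\<^sup>2 * q"
      using power_mono[OF p, of 2] by (simp add: power_mult_distrib q_def)
    have "(2 * norm x + 1) * norm z \<le> (2 * norm x + 1) * (a / (2 * (2 * norm x + 1)))"
      using z by (intro mult_left_mono) (auto simp: \<delta>_def)
    also have "\<dots> = a / 2"
    proof -
      have "2 * norm x + 1 \<noteq> 0" using norm_ge_zero[of x] by linarith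
      moreover have "c * (a / (2 * c)) = a / 2" if "c \<noteq> 0" for c using that by simp
      ultimately show ?thesis by blast
    qed
    finally have sm: "\<bar>p\<bar> + q \<le> a / 2" using p q by (simp add: algebra_simps)
    define L where "L d = ppow s (a + d) - a powr s - s * a powr (s - 1) * d" for d
    have "\<bar>L (- p - q)\<bar> \<le> K * (- p - q)\<^sup>2" "\<bar>L (p - q)\<bar> \<le> K * (p - q)\<^sup>2"
      unfolding L_def K_def using sm q by (intro ppow_linearization s a; linarith)+
    moreover have "R - (x + z) \<bullet> (x + z) = a + (- p - q)" "R - (x - z) \<bullet> (x - z) = a + (p - q)"
      by (auto simp: a_def p_def q_def power2_norm_eq_inner inner_simps inner_commute)
    then have "D z = 2 * ppow s a - ppow s (a + (- p - q)) - ppow s (a + (p - q))"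
      by (simp only: D_def bump_def a_def[symmetric])
    then have "D z = - L (- p - q) - L (p - q) + 2 * (s * a powr (s - 1)) * q"
      using a by (simp add: L_def algebra_simps)
    ultimately have "\<bar>D z\<bar> \<le> K * (- p - q)\<^sup>2 + K * (p - q)\<^sup>2 + 2 * (s * a powr (s - 1)) * q"
      using q s by (smt (verit) mult_nonneg_nonneg powr_ge_zero)
    also have "\<dots> = 2 * K * (p\<^sup>2 + q\<^sup>2) + 2 * (s * a powr (s - 1)) * q"
      by (simp add: power2_eq_square algebra_simps)
    also have "\<dots> \<le> 2 * K * (4 * (norm x)\<^sup>2 * q + q) + 2 * (s * a powr (s - 1)) * q"
      using p2 q K by (intro add_right_mono mult_left_mono add_mono) auto
    also have "\<dots> = C1 * q" by (simp add: C1_def algebra_simps)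
    finally show ?thesis using q by (simp add: q_def min_def)
  qed
  have large: "\<bar>D z\<bar> \<le> C2 * min 1 ((norm z)\<^sup>2)" if z: "norm z > \<delta>" for z
  proof -
    have "\<bar>D z\<bar> \<le> 2 * R powr s"
      using bump_bounds[of s R x] bump_bounds[of s R "x + z"] bump_bounds[of s R "x - z"] s R
      by (simp add: D_def)
    also have "\<dots> = C2 * \<delta>\<^sup>2" using \<delta> by (simp add: C2_def)
    also have "\<dots> \<le> C2 * min 1 ((norm z)\<^sup>2)"
      using \<delta> z C by (intro mult_left_mono) (auto intro!: power_mono power_le_one)
    finally show ?thesis .
  qed
  have "\<bar>D z\<bar> \<le> (C1 + C2) * min 1 ((norm z)\<^sup>2)" for z
    using small[of z] large[of z] C mult_right_mono[of C1 "C1 + C2" "min 1 ((norm z)\<^sup>2)"]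
      mult_right_mono[of C2 "C1 + C2" "min 1 ((norm z)\<^sup>2)"]
    by (cases "norm z \<le> \<delta>") auto
  then show thesis by (intro that) (simp add: D_def)
qed

section \<open>The fractional Laplacian of the bump functions\<close>

definition bump_integrand :: "real \<Rightarrow> real \<Rightarrow> 'a::euclidean_space \<Rightarrow> 'a \<Rightarrow> real" where
  "bump_integrand s R x z =
     (2 * bump s R x - bump s R (x + z) - bump s R (x - z)) / norm z powr (real DIM('a) + 2 * s)"

lemma measurable_bump_integrand [measurable]: "bump_integrand s R x \<in> borel_measurable borel"
  unfolding bump_integrand_def[abs_def] by measurable

text \<open>
  The value of the \<open>Lim\<close> is irrelevant; what matters is that it contains neither \<open>R\<close> nor \<open>x\<close>.
\<close>

lemma bump_integrand_polar:
  fixes x :: "'a::euclidean_space"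
  assumes s: "0 < s" "s < 1" and x: "x \<bullet> x < R"
  shows "integrable lborel (bump_integrand s R x)"
    and "ln 2 * (LINT z|lborel. bump_integrand s R x z)
      = (LINT y|lborel. LINT v|lborel. dilation_weight (y, v) * bump_integrand s R x (y /\<^sub>R v))"
    and "AE y in lborel. (LINT v|lborel. dilation_weight (y, v) * bump_integrand s R x (y /\<^sub>R v))
      = indicator {1..2} (norm y) / norm y powr (real DIM('a) + 2 * s) *
        Lim at_top (\<lambda>W. W powr (2 * s) / s - chord_primitive s (\<lambda>r. r - (norm y)\<^sup>2) (W\<^sup>2))"
proof -
  define f where f_bump: "f = bump_integrand s R x"
  have f_def: "f = (\<lambda>z. (2 * bump s R x - bump s R (x + z) - bump s R (x - z)) / norm z powr (real DIM('a) + 2 * s))"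
    by (simp add: f_bump bump_integrand_def fun_eq_iff)
  have [measurable]: "f \<in> borel_measurable borel" unfolding f_def by measurable
  obtain C where C: "\<And>z. \<bar>2 * bump s R x - bump s R (x + z) - bump s R (x - z)\<bar> \<le> C * min 1 ((norm z)\<^sup>2)"
    using bump_second_difference[OF s x] by blast
  have "integrable lborel (\<lambda>z::'a. C * (min 1 ((norm z)\<^sup>2) / norm z powr (real DIM('a) + 2 * s)))"
    by (intro integrable_mult_right integrable_min_one_norm_powr s)
  then have int: "integrable lborel f"
  proof (rule Bochner_Integration.integrable_bound)
    show "AE z in lborel. norm (f z) \<le> norm (C * (min 1 ((norm z)\<^sup>2) / norm z powr (real DIM('a) + 2 * s)))"
    proof (rule AE_I2)
      fix z :: 'a
      have "norm (f z) \<le> C * min 1 ((norm z)\<^sup>2) / norm z powr (real DIM('a) + 2 * s)"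
        unfolding f_def using C[of z] by (simp add: divide_right_mono)
      also have "\<dots> \<le> norm (C * (min 1 ((norm z)\<^sup>2) / norm z powr (real DIM('a) + 2 * s)))"
        unfolding real_norm_def times_divide_eq_right by (rule abs_ge_self)
      finally show "norm (f z) \<le> norm (C * (min 1 ((norm z)\<^sup>2) / norm z powr (real DIM('a) + 2 * s)))" .
    qed
  qed simp
  then show "integrable lborel (bump_integrand s R x)" by (simp add: f_bump)
  define a where "a = R - x \<bullet> x"
  have a: "a > 0" using x by (simp add: a_def)
  define w where "w y = indicator {1..2} (norm y) / norm y powr (real DIM('a) + 2 * s)" for y :: 'a
  \<comment> \<open>Counting powers of \<open>v\<close> with \<open>n\<close> the dimension: the
    second difference contributes \<open>-2s\<close>, the denominator \<open>n + 2s\<close> and the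
    weight \<open>-n - 1\<close>. What remains is the \<open>1 / v\<close> of
    \<open>chord_integrand\<close>.\<close>
  have eq: "dilation_weight (y, v) * f (y /\<^sub>R v) = w y * (indicator {0<..} v * chord_integrand s a ((norm y)\<^sup>2) (x \<bullet> y) v)" for y v
  proof (cases "norm y \<in> {1..2} \<and> v > 0")
    case True
    define P where "P = 2 * a powr s * v powr (2 * s) - ppow s (chord_quad a ((norm y)\<^sup>2) (x \<bullet> y) v)
      - ppow s (chord_quad a ((norm y)\<^sup>2) (- (x \<bullet> y)) v)"
    have v: "v > 0" and y: "norm y > 0" using True by auto
    have v2: "(1 / v)\<^sup>2 powr s = v powr (- 2 * s)"
      using v by (simp add: power2_powr powr_divide powr_minus_divide)
    have sc: "ppow s ((1 / v)\<^sup>2 * q) = v powr (- 2 * s) * ppow s q" for q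
      using v by (subst ppow_mult) (auto simp: v2)
    have "R - (x + y /\<^sub>R v) \<bullet> (x + y /\<^sub>R v) = (1 / v)\<^sup>2 * chord_quad a ((norm y)\<^sup>2) (x \<bullet> y) v"
         "R - (x - y /\<^sub>R v) \<bullet> (x - y /\<^sub>R v) = (1 / v)\<^sup>2 * chord_quad a ((norm y)\<^sup>2) (- (x \<bullet> y)) v"
      using v unfolding a_def chord_quad_def power2_norm_eq_inner
      by (auto simp: inner_simps inner_commute field_simps power2_eq_square)
    then have b: "bump s R (x + y /\<^sub>R v) = v powr (- 2 * s) * ppow s (chord_quad a ((norm y)\<^sup>2) (x \<bullet> y) v)"
      "bump s R (x - y /\<^sub>R v) = v powr (- 2 * s) * ppow s (chord_quad a ((norm y)\<^sup>2) (- (x \<bullet> y)) v)"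
      by (simp_all only: bump_def sc)
    have "bump s R x = v powr (- 2 * s) * (a powr s * v powr (2 * s))"
      using a v by (simp add: bump_def a_def powr_minus field_simps)
    with b have "2 * bump s R x - bump s R (x + y /\<^sub>R v) - bump s R (x - y /\<^sub>R v) = v powr (- 2 * s) * P"
      by (simp add: P_def algebra_simps)
    moreover have "norm (y /\<^sub>R v) powr (real DIM('a) + 2 * s)
       = norm y powr (real DIM('a) + 2 * s) / (v ^ DIM('a) * v powr (2 * s))"
    proof -
      have "norm (y /\<^sub>R v) = norm y / v" using v by (simp add: divide_inverse_commute)
      then show ?thesis using v y by (simp add: powr_divide powr_add powr_realpow)
    qed
    ultimately have "f (y /\<^sub>R v) = v powr (- 2 * s) * P / (norm y powr (real DIM('a) + 2 * s) / (v ^ DIM('a) * v powr (2 * s)))"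
      by (simp only: f_def)
    also have "\<dots> = P * v ^ DIM('a) / norm y powr (real DIM('a) + 2 * s)"
      using v by (simp add: powr_minus field_simps)
    finally show ?thesis using True
      by (simp add: dilation_weight_def w_def chord_integrand_def P_def[symmetric])
  qed (auto simp: dilation_weight_def w_def indicator_def)
  have intp: "integrable (lborel \<Otimes>\<^sub>M lborel) (\<lambda>p. dilation_weight p * f (fst p /\<^sub>R snd p))"
    using int by (subst integrable_dilation_iff) auto
  have "ln 2 * (LINT z|lborel. f z) = (LINT p|(lborel \<Otimes>\<^sub>M lborel). dilation_weight p * f (fst p /\<^sub>R snd p))"
    by (rule integral_dilation[symmetric]) simp
  also have "\<dots> = (LINT y|lborel. LINT v|lborel. dilation_weight (y, v) * f (y /\<^sub>R v))"
    using lborel_pair.integral_fst'[OF intp] by simp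
  finally show "ln 2 * (LINT z|lborel. bump_integrand s R x z)
      = (LINT y|lborel. LINT v|lborel. dilation_weight (y, v) * bump_integrand s R x (y /\<^sub>R v))"
    by (simp add: f_bump)
  \<comment> \<open>Fubini supplies integrability in \<open>v\<close> for almost every
    \<open>y\<close> only; on the annulus the nonzero factor \<open>w y\<close> can be divided out
    to reach the hypothesis of \<open>integral_chord_integrand\<close>.\<close>
  have "AE y in lborel. integrable lborel (\<lambda>v. dilation_weight (y, v) * f (y /\<^sub>R v))"
    using lborel_pair.AE_integrable_fst'[OF intp] by simp
  then have "AE y in lborel. (LINT v|lborel. dilation_weight (y, v) * f (y /\<^sub>R v))
    = w y * Lim at_top (\<lambda>W. W powr (2 * s) / s - chord_primitive s (\<lambda>r. r - (norm y)\<^sup>2) (W\<^sup>2))"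
  proof eventually_elim
    case (elim y)
    show ?case
    proof (cases "norm y \<in> {1..2}")
      case True
      then have "w y \<noteq> 0" "(norm y)\<^sup>2 > 0" by (auto simp: w_def)
      with elim have "set_integrable lborel {0<..} (chord_integrand s a ((norm y)\<^sup>2) (x \<bullet> y))"
        by (simp add: eq set_integrable_def)
      from integral_chord_integrand[OF s a \<open>(norm y)\<^sup>2 > 0\<close> this] show ?thesis
        by (simp add: eq set_lebesgue_integral_def)
    qed (simp add: eq w_def)
  qed
  then show "AE y in lborel. (LINT v|lborel. dilation_weight (y, v) * bump_integrand s R x (y /\<^sub>R v))
      = indicator {1..2} (norm y) / norm y powr (real DIM('a) + 2 * s) *
        Lim at_top (\<lambda>W. W powr (2 * s) / s - chord_primitive s (\<lambda>r. r - (norm y)\<^sup>2) (W\<^sup>2))"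
    by (simp add: w_def f_bump)
qed

text \<open>This is the constancy in Getoor's theorem, without the value of the constant: for both
  pairs the inner integrals agree with the same function of \<open>y\<close> almost
  everywhere.\<close>

lemma integral_bump_integrand:
  fixes x x' :: "'a::euclidean_space"
  assumes s: "0 < s" "s < 1" and x: "x \<bullet> x < R" and x': "x' \<bullet> x' < R'"
  shows "(LINT z|lborel. bump_integrand s R x z) = (LINT z|lborel. bump_integrand s R' x' z)"
proof -
  have "AE y in lborel. (LINT v|lborel. dilation_weight (y, v) * bump_integrand s R x (y /\<^sub>R v))
     = (LINT v|lborel. dilation_weight (y, v) * bump_integrand s R' x' (y /\<^sub>R v))"
    using bump_integrand_polar(3)[OF s x] bump_integrand_polar(3)[OF s x'] by eventually_elim simp
  then have "ln 2 * (LINT z|lborel. bump_integrand s R x z) = ln 2 * (LINT z|lborel. bump_integrand s R' x' z)"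
    unfolding bump_integrand_polar(2)[OF s x] bump_integrand_polar(2)[OF s x']
    by (intro integral_cong_AE) auto
  then show ?thesis by simp
qed

section \<open>Smoothness of radial functions\<close>

lemma C2_on_radial:
  fixes p p' p'' :: "real \<Rightarrow> real"
  assumes S: "\<And>x. x \<in> S \<Longrightarrow> x \<bullet> x \<in> T"
    and p: "\<And>t. t \<in> T \<Longrightarrow> (p has_real_derivative p' t) (at t)"
    and p': "\<And>t. t \<in> T \<Longrightarrow> (p' has_real_derivative p'' t) (at t)"
    and cont: "continuous_on T p''"
  shows "C2_on S (\<lambda>x::'a::euclidean_space. p (x \<bullet> x))"
proof -
  \<comment> \<open>The gradient is \<open>2 p' x\<close> and the Hessian is \<open>4 p''\<close>
    times the rank-one form of \<open>x\<close> plus \<open>2 p'\<close> times the identity, with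
    \<open>p'\<close> and \<open>p''\<close> taken at \<open>x \<bullet> x\<close>.\<close>
  define u' :: "'a \<Rightarrow> 'a \<Rightarrow>\<^sub>L real" where "u' x = (2 * p' (x \<bullet> x)) *\<^sub>R blinfun_inner_left x" for x
  define u'' :: "'a \<Rightarrow> 'a \<Rightarrow>\<^sub>L 'a \<Rightarrow>\<^sub>L real" where
    "u'' x = (4 * p'' (x \<bullet> x)) *\<^sub>R (blinfun_scaleR_left (blinfun_inner_left x) o\<^sub>L blinfun_inner_left x)
       + (2 * p' (x \<bullet> x)) *\<^sub>R Blinfun blinfun_inner_left" for x
  have sq: "((\<lambda>x::'a. x \<bullet> x) has_derivative (\<lambda>h. 2 * (h \<bullet> x))) (at x)" for x
    by (auto intro!: derivative_eq_intros simp: inner_commute)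
  have comp: "((\<lambda>x::'a. q (x \<bullet> x)) has_derivative (\<lambda>h. d * (2 * (h \<bullet> x)))) (at x)"
    if "(q has_real_derivative d) (at (x \<bullet> x))" for q d x
    using has_derivative_compose[OF sq has_field_derivative_imp_has_derivative[OF that]] by simp
  have "((\<lambda>x. p (x \<bullet> x)) has_derivative blinfun_apply (u' x)) (at x)" if "x \<in> S" for x
    using comp[OF p[OF S[OF that]]]
    by (rule has_derivative_eq_rhs) (simp add: u'_def fun_eq_iff blinfun.scaleR_left)
  moreover have "(u' has_derivative blinfun_apply (u'' x)) (at x)" if "x \<in> S" for x
  proof -
    have "((\<lambda>x. 2 * p' (x \<bullet> x)) has_derivative (\<lambda>h. 2 * (p'' (x \<bullet> x) * (2 * (h \<bullet> x))))) (at x)"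
      by (intro has_derivative_mult_right comp p' S that)
    from has_derivative_scaleR[OF this bounded_linear_imp_has_derivative[OF bounded_linear_blinfun_inner_left]]
    show ?thesis unfolding u'_def
      by (rule has_derivative_eq_rhs)
         (simp add: u''_def fun_eq_iff blinfun.add_left blinfun.scaleR_left
           bounded_linear_Blinfun_apply[OF bounded_linear_blinfun_inner_left])
  qed
  moreover have "continuous_on S u''"
  proof -
    have ip: "continuous_on S (\<lambda>x. x \<bullet> x)" by (intro continuous_intros)
    have "continuous_on T p'"
      using p' by (meson DERIV_continuous_on has_field_derivative_at_within)
    from continuous_on_compose2[OF this ip] continuous_on_compose2[OF cont ip]
    have "continuous_on S (\<lambda>x. p' (x \<bullet> x))" "continuous_on S (\<lambda>x. p'' (x \<bullet> x))"
      using S by auto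
    then show ?thesis unfolding u''_def
      by (intro continuous_intros bounded_bilinear.continuous_on[OF bounded_bilinear_blinfun_compose]
        bounded_linear.continuous_on[OF bounded_linear_blinfun_scaleR_left]
        bounded_linear.continuous_on[OF bounded_linear_blinfun_inner_left])
  qed
  ultimately show ?thesis unfolding C2_on_def by blast
qed

lemma DERIV_ppow:
  assumes "t > 0"
  shows "(ppow s has_real_derivative s * t powr (s - 1)) (at t)"
proof (rule DERIV_cong_ev[THEN iffD2, OF refl _ refl])
  show "\<forall>\<^sub>F t' in nhds t. ppow s t' = t' powr s"
    using eventually_nhds_in_open[of "{0<..}" t] assms by (auto elim: eventually_mono)
qed (use assms in \<open>auto intro!: has_real_derivative_powr\<close>)

lemma integrable_lebesgue_if_lborel:
  fixes f :: "'a::euclidean_space \<Rightarrow> real"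
  assumes "integrable lborel f"
  shows "integrable lebesgue f" "(LINT x|lebesgue. f x) = (LINT x|lborel. f x)"
  using assms borel_measurable_integrable[OF assms]
  by (simp_all add: integrable_completion integral_completion)

section \<open>The counterexample \<open>h_4 - h_1 - (4 powr s - 1)\<close>\<close>

theorem theorem5:
  fixes s :: real
  assumes "0 < s" and "s < 1"
  shows "\<exists>u :: real ^ 'n \<Rightarrow> real.
           bounded (range u) \<and>
           s_harmonic_on s (ball 0 1) u \<and>
           (\<forall>x\<in>ball 0 1. u x \<ge> 0) \<and>
           (\<exists>x\<in>ball 0 1. u x \<noteq> 0) \<and>
           (INF x\<in>ball 0 (1/2). u x) = 0"
proof -
  note s = assms
  \<comment> \<open>\<open>p\<close> is the profile in \<open>t = x \<bullet> x\<close>. The unit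
    ball lies in the positivity set of both bumps, and the constant \<open>4 powr s - 1\<close> is
    their difference at the origin, so \<open>p 0 = 0\<close>.\<close>
  define p where "p t = ppow s (4 - t) - ppow s (1 - t) - (4 powr s - 1)" for t
  define p' where "p' t = s * (1 - t) powr (s - 1) - s * (4 - t) powr (s - 1)" for t
  define p'' where "p'' t = s * (1 - s) * (1 - t) powr (s - 2) - s * (1 - s) * (4 - t) powr (s - 2)" for t
  define u :: "real ^ 'n \<Rightarrow> real" where "u x = p (x \<bullet> x)" for x
  have u_bump: "u x = bump s 4 x - bump s 1 x - (4 powr s - 1)" for x
    by (simp add: u_def p_def bump_def)
  have p_deriv: "(p has_real_derivative p' t) (at t)" if "t < 1" for t
    unfolding p_def p'_def using that
    by (auto intro!: derivative_eq_intros DERIV_chain2[OF DERIV_ppow])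
  have p'_deriv: "(p' has_real_derivative p'' t) (at t)" if "t < 1" for t
    unfolding p'_def p''_def using that
    by (auto intro!: derivative_eq_intros simp: algebra_simps)
  have ball: "x \<in> ball 0 1 \<longleftrightarrow> x \<bullet> x < 1" for x :: "real ^ 'n"
    by (simp add: norm_lt_square)
  \<comment> \<open>The exponent \<open>s - 1\<close> is negative, so the smaller base
    \<open>1 - t\<close> has the larger power.\<close>
  have p'_pos: "p' t > 0" if "t < 1" for t
    unfolding p'_def using that s powr_less_mono2_neg[of "s - 1" "1 - t" "4 - t"] by simp
  have p0: "p 0 = 0" by (simp add: p_def)
  have p_pos: "p t > 0" if "0 < t" "t < 1" for t
  proof -
    have "p 0 < p t"
      using that p_deriv p'_pos
      by (intro DERIV_pos_imp_increasing[OF that(1), of p]) (meson le_less_trans)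
    then show ?thesis by (simp add: p0)
  qed
  have nonneg: "u x \<ge> 0" if "x \<in> ball 0 1" for x
    using p_pos[of "x \<bullet> x"] p0 that inner_ge_zero[of x] unfolding ball u_def
    by (cases "x \<bullet> x = 0") auto
  have bounded: "bounded (range u)"
  proof (rule boundedI)
    fix y assume "y \<in> range u"
    then obtain x where "y = u x" by auto
    then show "norm y \<le> 4 powr s + 1 + \<bar>4 powr s - 1\<bar>"
      using bump_bounds[of s 4 x] bump_bounds[of s 1 x] s by (simp add: u_bump)
  qed
  have "s_harmonic_on s (ball 0 1) u"
    unfolding s_harmonic_on_def
  proof (intro conjI ballI)
    have "u \<in> borel_measurable borel" unfolding u_bump[abs_def] by measurable
    then show "u \<in> borel_measurable lebesgue" by (simp add: measurable_completion)
    show "C2_on (ball 0 1) u" unfolding u_def[abs_def]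
    proof (rule C2_on_radial[where T = "{..<1}" and p' = p' and p'' = p''])
      show "continuous_on {..<1} p''" unfolding p''_def
        by (intro continuous_intros) auto
      show "x \<bullet> x \<in> {..<1}" if "x \<in> ball 0 1" for x :: "real ^ 'n" using ball that by blast
    qed (use p_deriv p'_deriv in auto)
    fix x :: "real ^ 'n" assume "x \<in> ball 0 1"
    then have "x \<bullet> x < 1" using ball by blast
    then have x: "x \<bullet> x < 1" "x \<bullet> x < 4" by auto
    \<comment> \<open>The additive constant cancels in the second difference. What is left is the
      difference of two integrands at the same \<open>x\<close>, with \<open>R = 4\<close> and
      \<open>R = 1\<close>, whose integrals coincide.\<close>
    have eq: "frac_integrand s u x = (\<lambda>y. bump_integrand s 4 x y - bump_integrand s 1 x y)"
      by (simp add: fun_eq_iff frac_integrand_def bump_integrand_def u_bump diff_divide_distrib[symmetric])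
    have int: "integrable lborel (frac_integrand s u x)"
      unfolding eq by (intro Bochner_Integration.integrable_diff bump_integrand_polar(1) s x)
    have "(LINT y|lborel. frac_integrand s u x y) = 0"
      unfolding eq using integral_bump_integrand[OF s x(2) x(1)]
      by (subst Bochner_Integration.integral_diff) (auto intro!: bump_integrand_polar(1) s x)
    then show "s_harmonic_at s u x"
      using integrable_lebesgue_if_lborel[OF int] by (simp add: s_harmonic_at_def frac_laplacian_def)
  qed
  moreover have "\<exists>x\<in>ball 0 1. u x \<noteq> 0"
  proof
    \<comment> \<open>Any point of the unit ball other than the origin serves; the index
      \<open>undefined\<close> is an arbitrary coordinate.\<close>
    let ?x = "(1 / 2) *\<^sub>R axis undefined 1 :: real ^ 'n"
    have xx: "?x \<bullet> ?x = 1 / 4" by (simp add: inner_axis_axis)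
    then show "?x \<in> ball 0 1" unfolding ball by simp
    have "p (1 / 4) \<noteq> 0" using p_pos[of "1 / 4"] by simp
    then show "u ?x \<noteq> 0" by (simp only: u_def xx not_False_eq_True)
  qed
  moreover have "(INF x\<in>ball 0 (1/2). u x) = 0"
  \<comment> \<open>The infimum is attained at the origin.\<close>
  proof (rule cInf_eq_minimum)
    show "0 \<in> u ` ball 0 (1 / 2)" using p0 by (auto simp: u_def image_iff intro!: bexI[of _ 0])
  qed (auto intro!: nonneg)
  ultimately show ?thesis using bounded nonneg by blast
qed

end
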